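(* Let $A$ be a C*-algebra with a commutative C*-subalgebra $E$ containing an approximate unit for $A$. Then $E_*\subseteq\overline{E_{\mathrm{sa}\bullet}}$. If $E$ is also maximal commutative then $E_*=\overline{E_{\mathrm{sa}\bullet}}$.
   Context: $E_*=\{a\in A:a^*Ea\cup aEa^*\subseteq E\}$ is the set of $*$-normalisers of $E$ in $A$. $E_{\mathrm{sa}}=\{e\in E:e=e^*\}$, and $E_{\mathrm{sa}\bullet}=\{a\in A:aE_{\mathrm{sa}}=E_{\mathrm{sa}}a\}$ is the set of normalisers of $E_{\mathrm{sa}}$ in $A$, where $aE_{\mathrm{sa}}=\{ae:e\in E_{\mathrm{sa}}\}$ and $E_{\mathrm{sa}}a=\{ea:e\in E_{\mathrm{sa}}\}$. The bar denotes norm closure. *)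

theory Defs
  imports "HOL-Analysis.Analysis"
begin

text \<open>
  C*-algebras, not assumed unital and possibly zero. The algebra is the whole type. The real scalar
  multiplication of \<^class>\<open>real_normed_algebra\<close> is the restriction of the complex one.
\<close>

class cstar_algebra = real_normed_algebra + complete_space +
  fixes scaleC :: "complex \<Rightarrow> 'a \<Rightarrow> 'a"  (infixr "*\<^sub>C" 75)
    and star :: "'a \<Rightarrow> 'a"  ("(_\<^sup>\<star>)" [1000] 1000)
  assumes scaleC_add_right: "c *\<^sub>C (x + y) = c *\<^sub>C x + c *\<^sub>C y"
    and scaleC_add_left: "(c + d) *\<^sub>C x = c *\<^sub>C x + d *\<^sub>C x"
    and scaleC_scaleC: "c *\<^sub>C d *\<^sub>C x = (c * d) *\<^sub>C x"
    and scaleR_scaleC: "r *\<^sub>R x = complex_of_real r *\<^sub>C x"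
    and norm_scaleC: "norm (c *\<^sub>C x) = cmod c * norm x"
    and mult_scaleC_left: "(c *\<^sub>C x) * y = c *\<^sub>C (x * y)"
    and mult_scaleC_right: "x * (c *\<^sub>C y) = c *\<^sub>C (x * y)"
    and star_star: "(x\<^sup>\<star>)\<^sup>\<star> = x"
    and star_add: "(x + y)\<^sup>\<star> = x\<^sup>\<star> + y\<^sup>\<star>"
    and star_scaleC: "(c *\<^sub>C x)\<^sup>\<star> = cnj c *\<^sub>C x\<^sup>\<star>"
    and star_mult: "(x * y)\<^sup>\<star> = y\<^sup>\<star> * x\<^sup>\<star>"
    and cstar_identity: "norm (x\<^sup>\<star> * x) = (norm x)\<^sup>2"

instantiation complex :: cstar_algebra
begin

definition scaleC_complex :: "complex \<Rightarrow> complex \<Rightarrow> complex"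
  where "scaleC_complex c x = c * x"

definition star_complex :: "complex \<Rightarrow> complex"
  where "star_complex = cnj"

instance
  by standard
    (simp_all add: scaleC_complex_def star_complex_def algebra_simps norm_mult power2_eq_square
      scaleR_conv_of_real)

end

definition cstar_subalgebra :: "'a::cstar_algebra set \<Rightarrow> bool"
  where "cstar_subalgebra E \<longleftrightarrow>
    0 \<in> E \<and>
    (\<forall>x\<in>E. \<forall>y\<in>E. x + y \<in> E) \<and>
    (\<forall>c. \<forall>x\<in>E. c *\<^sub>C x \<in> E) \<and>
    (\<forall>x\<in>E. \<forall>y\<in>E. x * y \<in> E) \<and>
    (\<forall>x\<in>E. x\<^sup>\<star> \<in> E) \<and>
    closed E"

definition commutative_cstar_subalgebra :: "'a::cstar_algebra set \<Rightarrow> bool"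
  where "commutative_cstar_subalgebra E \<longleftrightarrow>
    cstar_subalgebra E \<and> (\<forall>x\<in>E. \<forall>y\<in>E. x * y = y * x)"

definition maximal_commutative :: "'a::cstar_algebra set \<Rightarrow> bool"
  where "maximal_commutative E \<longleftrightarrow>
    commutative_cstar_subalgebra E \<and>
    (\<forall>F. commutative_cstar_subalgebra F \<longrightarrow> E \<subseteq> F \<longrightarrow> F = E)"

text \<open>
  A net is a family \<open>u\<close> indexed by a type together with a proper filter \<open>D\<close> on that type; for a
  directed index set, \<open>D\<close> is the filter of its tails. The members of the net are not required to be
  positive, contractive or increasing, so every stricter notion of approximate unit in use is an
  instance of this one.
\<close>

definition approximate_unit :: "('i \<Rightarrow> 'a::cstar_algebra) \<Rightarrow> 'i filter \<Rightarrow> bool"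
  where "approximate_unit u D \<longleftrightarrow>
    D \<noteq> bot \<and>
    (\<forall>a. ((\<lambda>i. u i * a) \<longlongrightarrow> a) D \<and> ((\<lambda>i. a * u i) \<longlongrightarrow> a) D)"

definition star_normalisers :: "'a::cstar_algebra set \<Rightarrow> 'a set"
  where "star_normalisers E =
    {a. (\<lambda>e. a\<^sup>\<star> * e * a) ` E \<union> (\<lambda>e. a * e * a\<^sup>\<star>) ` E \<subseteq> E}"

definition self_adjoint_part :: "'a::cstar_algebra set \<Rightarrow> 'a set"
  where "self_adjoint_part E = {e \<in> E. e = e\<^sup>\<star>}"

definition normalisers :: "'a::cstar_algebra set \<Rightarrow> 'a set"
  where "normalisers S = {a. (\<lambda>s. a * s) ` S = (\<lambda>s. s * a) ` S}"

end

theory Submission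
  imports Defs "HOL-Complex_Analysis.Cauchy_Integral_Formula"
begin

text \<open>
  Let \<open>a\<close> be a \<open>*\<close>-normaliser of \<open>E\<close>. Passing to the limit along the approximate unit puts
  \<open>a\<^sup>\<star> * a\<close> and \<open>y = a * a\<^sup>\<star>\<close> into \<open>E\<close>. If \<open>y\<close> were invertible, then for self-adjoint \<open>e\<close> in \<open>E\<close>,
  \<open>a * e = y\<^sup>-\<^sup>1 * (a * a\<^sup>\<star>) * a * e = (y\<^sup>-\<^sup>1 * (a * e * a\<^sup>\<star>)) * a\<close> would write \<open>a * e\<close> as an element of
  \<open>E\<close> times \<open>a\<close>, and symmetrically on the other side. In general, let \<open>g\<close> be a continuous function
  that vanishes near \<open>0\<close> and let \<open>h\<close> be a continuous function that is \<open>1/t\<close> on the support of \<open>g\<close>.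
  Then \<open>h(y)\<close> can stand for the inverse on \<open>c = g(y) a\<close>, which is therefore a normaliser of
  the self-adjoint part. Moreover \<open>\<parallel>a - c\<parallel>\<^sup>2\<close> is the norm of \<open>(1 - g)\<^sup>2(y) y\<close>, which is small when \<open>g\<close>
  is \<open>1\<close> outside a small neighbourhood of \<open>0\<close>. This is \<open>near_normaliser\<close>.

  The argument needs a continuous functional calculus for one self-adjoint element \<open>x\<close>, with
  \<open>\<parallel>f(x)\<parallel> \<le> sup \<bar>f\<bar>\<close> over some bounded interval, however large, because only \<open>t (1 - g(t))\<^sup>2\<close> has
  to be small; here \<open>x\<close> is scaled to norm at most \<open>1/2\<close> and the interval is \<open>[-1, 1]\<close>. For want of a
  unit in the algebra, \<open>f(x)\<close> is treated as the operator \<open>z \<mapsto> f(x) z\<close> on the algebra. For a polynomial the estimate is \<open>norm_poly_op_le\<close>: \<open>x\<close> is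
  the real part of a unitary \<open>W = x + \<i> sqrt(1 - x\<^sup>2)\<close>, so \<open>p(x)\<close> is \<open>W\<close> to some negative power times a
  polynomial in \<open>W\<close>, whose coefficients are bounded by the supremum of \<open>\<bar>p\<bar>\<close>. This gives the estimate
  with a factor linear in the degree, and applying it to high powers of \<open>p\<close> removes the factor. The
  Weierstrass theorem then extends the calculus to continuous functions.

  Conversely, let \<open>E\<close> be maximal commutative and let \<open>a\<close> normalise the self-adjoint part. Moving
  a self-adjoint \<open>f\<close> in \<open>E\<close> through \<open>a\<close>, and through \<open>a\<^sup>\<star>\<close> by the adjoint relation, shows that
  \<open>a\<^sup>\<star> * e * a\<close> and \<open>a * e * a\<^sup>\<star>\<close> commute with \<open>f\<close>; by maximality they lie in \<open>E\<close>. Since the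
  \<open>*\<close>-normalisers form a closed set, the closure of the normalisers is contained in it.
\<close>

section \<open>Polynomials of an operator\<close>

definition poly_op :: "real poly \<Rightarrow> ('a::real_vector \<Rightarrow> 'a) \<Rightarrow> 'a \<Rightarrow> 'a"
  where "poly_op p T z = (\<Sum>i\<le>degree p. coeff p i *\<^sub>R (T ^^ i) z)"

lemma poly_op_altdef:
  assumes "degree p \<le> n"
  shows "poly_op p T z = (\<Sum>i\<le>n. coeff p i *\<^sub>R (T ^^ i) z)"
  unfolding poly_op_def using assms
  by (intro sum.mono_neutral_left) (auto simp: coeff_eq_0)

lemma poly_op_0 [simp]: "poly_op 0 T z = 0"
  by (simp add: poly_op_def)

lemma poly_op_pCons:
  assumes "linear T"
  shows "poly_op (pCons c p) T z = c *\<^sub>R z + T (poly_op p T z)"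
proof -
  have "poly_op (pCons c p) T z = (\<Sum>i\<le>Suc (degree p). coeff (pCons c p) i *\<^sub>R (T ^^ i) z)"
    by (rule poly_op_altdef) (rule degree_pCons_le)
  also have "\<dots> = c *\<^sub>R z + (\<Sum>i\<le>degree p. coeff p i *\<^sub>R T ((T ^^ i) z))"
    by (subst sum.atMost_Suc_shift) simp
  also have "(\<Sum>i\<le>degree p. coeff p i *\<^sub>R T ((T ^^ i) z)) = T (poly_op p T z)"
    using assms by (simp add: poly_op_def linear_sum linear_scale)
  finally show ?thesis .
qed

lemma linear_poly_op:
  assumes "linear T"
  shows "linear (poly_op p T)"
proof (induction p)
  case 0
  show ?case by (simp add: poly_op_def linear_iff)
next
  case (pCons c p)
  then show ?case
    using assms by (simp add: linear_iff poly_op_pCons algebra_simps)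
qed

lemma poly_op_add:
  assumes "linear T"
  shows "poly_op (p + q) T z = poly_op p T z + poly_op q T z"
  by (induction p q rule: poly_induct2)
    (simp_all add: assms poly_op_pCons linear_add algebra_simps)

lemma poly_op_smult:
  assumes "linear T"
  shows "poly_op (smult c p) T z = c *\<^sub>R poly_op p T z"
  by (induction p) (simp_all add: assms poly_op_pCons linear_scale algebra_simps)

lemma poly_op_diff:
  assumes "linear T"
  shows "poly_op (p - q) T z = poly_op p T z - poly_op q T z"
  using poly_op_add[OF assms, of p "smult (-1) q" z] poly_op_smult[OF assms, of "-1" q z]
  by simp

lemma poly_op_mult:
  assumes "linear T"
  shows "poly_op (p * q) T z = poly_op p T (poly_op q T z)"
  by (induction p)
    (simp_all add: assms poly_op_pCons poly_op_add poly_op_smult algebra_simps)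

lemma poly_op_monom:
  assumes "linear T"
  shows "poly_op (monom c n) T z = c *\<^sub>R (T ^^ n) z"
  by (induction n)
    (simp_all add: assms poly_op_pCons monom_0 monom_Suc linear_0 linear_scale)

lemma poly_op_complex_mult:
  "poly_op p (\<lambda>w. z * w) (v :: complex) = poly (map_poly of_real p) z * v"
proof (induction p)
  case (pCons c p)
  have "linear (\<lambda>w. z * w)" by (simp add: linear_iff algebra_simps)
  with pCons show ?case
    by (simp add: poly_op_pCons map_poly_pCons algebra_simps scaleR_conv_of_real)
qed simp

text \<open>
  On the unit circle the Joukowski map \<open>z \<mapsto> (z + z\<^sup>-\<^sup>1) / 2\<close> is the real part. If \<open>q\<close> has the
  coefficient list \<open>cs\<close> of length \<open>n\<close>, this is the polynomial \<open>z\<^sup>n q((z + z\<^sup>-\<^sup>1) / 2)\<close>, built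
  by the Horner scheme from \<open>z (z + z\<^sup>-\<^sup>1) / 2 = (z\<^sup>2 + 1) / 2\<close>.
\<close>
primrec joukowski :: "real list \<Rightarrow> real poly" where
  "joukowski [] = 0"
| "joukowski (c # cs) = monom c (Suc (length cs)) + [:1/2, 0, 1/2:] * joukowski cs"

lemma degree_joukowski: "degree (joukowski cs) \<le> 2 * length cs"
proof (induction cs)
  case (Cons c cs)
  have "degree ([:1/2, 0, 1/2:] * joukowski cs) \<le> 2 + degree (joukowski cs)"
    using degree_mult_le[of "[:1/2, 0, 1/2::real:]" "joukowski cs"] by simp
  with Cons show ?case
    using degree_monom_le[of c "Suc (length cs)"] by (auto intro!: degree_add_le)
qed simp

text \<open>
  The defining identity of \<open>joukowski\<close>, with \<open>W\<close> for \<open>z\<close> and \<open>X\<close> for \<open>(z + z\<^sup>-\<^sup>1) / 2\<close>. Since it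
  holds for operators on any real vector space, it applies both to multiplication by a complex number
  of modulus one and to the unitaries built below.
\<close>
lemma joukowski_op:
  assumes W: "linear W" and X: "linear X"
    and comm: "\<And>v. W (X v) = X (W v)"
    and quad: "\<And>v. 2 *\<^sub>R W (X v) = W (W v) + v"
  shows "poly_op (joukowski cs) W v = (W ^^ length cs) (poly_op (Poly cs) X v)"
proof (induction cs)
  case (Cons c cs)
  let ?n = "length cs" and ?u = "poly_op (Poly cs) X v"
  have lin: "linear (W ^^ k)" for k
    by (induction k) (use W in \<open>auto intro: linear_compose simp: linear_iff\<close>)
  have pow_comm: "(W ^^ k) (X u) = X ((W ^^ k) u)" for k u
    by (induction k) (simp_all add: comm)
  have half: "poly_op [:1/2, 0, 1/2:] W u = W (X u)" for u
  proof -
    have "2 *\<^sub>R poly_op [:1/2, 0, 1/2:] W u = 2 *\<^sub>R W (X u)"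
      using W by (simp add: poly_op_pCons quad linear_0 linear_scale algebra_simps)
    then show ?thesis by simp
  qed
  have "poly_op (joukowski (c # cs)) W v = c *\<^sub>R (W ^^ Suc ?n) v + W (X ((W ^^ ?n) ?u))"
    using W by (simp only: joukowski.simps poly_op_add poly_op_monom poly_op_mult half Cons)
  also have "\<dots> = (W ^^ Suc ?n) (c *\<^sub>R v + X ?u)"
    using lin[of "Suc ?n"] by (simp add: pow_comm linear_add linear_scale del: funpow.simps)
      (simp add: pow_comm comm)
  also have "c *\<^sub>R v + X ?u = poly_op (Poly (c # cs)) X v"
    using X by (simp add: poly_op_pCons)
  finally show ?case by simp
qed simp

text \<open>
  A coefficient is a Taylor coefficient at the centre of the disc, so the Cauchy inequality bounds it.
\<close>
lemma coeff_le_sup_on_circle: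
  fixes p :: "complex poly"
  assumes "\<And>z. cmod z = 1 \<Longrightarrow> cmod (poly p z) \<le> B"
  shows "cmod (coeff p n) \<le> B"
proof -
  have deriv: "(deriv ^^ k) (poly p) = poly ((pderiv ^^ k) p)" for k
    by (induction k) (auto intro!: ext DERIV_imp_deriv)
  have "cmod ((deriv ^^ n) (poly p) 0) \<le> fact n * B / 1 ^ n"
    by (rule Cauchy_inequality) (use assms in \<open>auto intro!: holomorphic_intros continuous_intros\<close>)
  also have "(deriv ^^ n) (poly p) 0 = fact n * coeff p n"
    by (simp add: deriv poly_0_coeff_0 coeff_higher_pderiv pochhammer_fact)
  finally show ?thesis
    by (simp add: norm_mult)
qed

text \<open>
  On the unit circle \<open>joukowski cs\<close> has the modulus of \<open>Poly cs\<close> at the real part of the point.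
\<close>
lemma coeff_joukowski_le:
  assumes "\<And>t. t \<in> {-1..1} \<Longrightarrow> \<bar>poly (Poly cs) t\<bar> \<le> B"
  shows "\<bar>coeff (joukowski cs) n\<bar> \<le> B"
proof -
  have "cmod (poly (map_poly of_real (joukowski cs)) z) \<le> B" if z: "cmod z = 1" for z
  proof -
    let ?t = "Re z"
    have "z * cnj z = 1"
      using z complex_norm_square[of z] by simp
    then have zt: "2 * (z * of_real ?t) = z * z + 1"
      using complex_add_cnj[of z] by (metis distrib_left mult.left_commute of_real_mult of_real_numeral)
    have "poly_op (joukowski cs) (\<lambda>w. z * w) (1::complex) =
        ((\<lambda>w. z * w) ^^ length cs) (poly_op (Poly cs) (\<lambda>w. of_real ?t * w) 1)"
    proof (rule joukowski_op)
      show "2 *\<^sub>R (z * (of_real ?t * v)) = z * (z * v) + v" for v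
        using arg_cong[OF zt, of "\<lambda>u. u * v"] by (simp add: scaleR_conv_of_real algebra_simps)
    qed (simp_all add: linear_iff algebra_simps)
    moreover have "((\<lambda>w. z * w) ^^ k) v = z ^ k * v" for k v
      by (induction k) simp_all
    moreover have "poly (map_poly of_real q) (of_real s) = (of_real (poly q s) :: complex)" for q s
      by (induction q) (simp_all add: map_poly_pCons)
    ultimately have "cmod (poly (map_poly of_real (joukowski cs)) z) = \<bar>poly (Poly cs) ?t\<bar>"
      by (simp add: poly_op_complex_mult norm_mult norm_power z)
    moreover have "?t \<in> {-1..1}"
      using abs_Re_le_cmod[of z] z by auto
    ultimately show ?thesis using assms by simp
  qed
  from coeff_le_sup_on_circle[OF this, of n] show ?thesis
    by (simp add: coeff_map_poly)
qed

lemma poly_op_isometry_bound: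
  fixes W :: "'a::real_normed_vector \<Rightarrow> 'a"
  assumes W: "\<And>v. norm (W v) = norm v"
    and deg: "degree p \<le> n" and coeff: "\<And>i. \<bar>coeff p i\<bar> \<le> B"
  shows "norm (poly_op p W v) \<le> real (Suc n) * B * norm v"
proof -
  have pow: "norm ((W ^^ k) v) = norm v" for k
    by (induction k) (simp_all add: W)
  have "norm (poly_op p W v) \<le> (\<Sum>i\<le>n. norm (coeff p i *\<^sub>R (W ^^ i) v))"
    unfolding poly_op_altdef[OF deg] by (rule norm_sum)
  also have "\<dots> \<le> (\<Sum>i\<le>n. B * norm v)"
    by (intro sum_mono) (simp add: pow coeff mult_right_mono)
  finally show ?thesis by simp
qed

text \<open>
  If \<open>X\<close> is the real part of an isometry \<open>W\<close>, then \<open>q(X)\<close> is, up to a power of \<open>W\<close>, a polynomial in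
  \<open>W\<close> with at most \<open>2 deg q + 3\<close> coefficients, each bounded by \<open>B\<close>, and powers of \<open>W\<close> preserve norms.
\<close>
lemma poly_op_isometry_sup_bound:
  fixes W :: "'a::real_normed_vector \<Rightarrow> 'a"
  assumes W: "linear W" "\<And>v. norm (W v) = norm v" and X: "linear X"
    and comm: "\<And>v. W (X v) = X (W v)"
    and quad: "\<And>v. 2 *\<^sub>R W (X v) = W (W v) + v"
    and bound: "\<And>t. t \<in> {-1..1} \<Longrightarrow> \<bar>poly q t\<bar> \<le> B"
  shows "norm (poly_op q X v) \<le> real (2 * degree q + 3) * B * norm v"
proof -
  let ?cs = "coeffs q"
  have pow: "norm ((W ^^ k) u) = norm u" for k u
    by (induction k) (simp_all add: W)
  have "length ?cs \<le> Suc (degree q)"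
    by (cases "q = 0") (simp_all add: length_coeffs_degree)
  then have deg: "degree (joukowski ?cs) \<le> 2 * degree q + 2"
    using degree_joukowski[of ?cs] by simp
  have "poly_op (joukowski ?cs) W v = (W ^^ length ?cs) (poly_op q X v)"
    using joukowski_op[OF W(1) X comm quad, of ?cs v] by simp
  then have "norm (poly_op q X v) = norm (poly_op (joukowski ?cs) W v)"
    by (simp add: pow)
  also have "\<dots> \<le> real (Suc (2 * degree q + 2)) * B * norm v"
    using bound by (intro poly_op_isometry_bound W(2) deg coeff_joukowski_le) simp
  finally show ?thesis by (simp add: algebra_simps)
qed

section \<open>Self-adjoint elements as real parts of unitaries\<close>

lemma norm_star: "norm (x\<^sup>\<star>) = norm (x :: 'a::cstar_algebra)"
proof -
  have *: "norm z \<le> norm (z\<^sup>\<star>)" for z :: 'a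
  proof (cases "z = 0")
    case False
    have "norm z * norm z \<le> norm (z\<^sup>\<star>) * norm z"
      using norm_mult_ineq[of "z\<^sup>\<star>" z] by (simp add: cstar_identity power2_eq_square)
    with False show ?thesis by simp
  qed simp
  from *[of x] *[of "x\<^sup>\<star>"] show ?thesis by (simp add: star_star)
qed

lemma star_scaleR: "(r *\<^sub>R x)\<^sup>\<star> = r *\<^sub>R (x :: 'a::cstar_algebra)\<^sup>\<star>"
  by (simp add: scaleR_scaleC star_scaleC)

lemma bounded_linear_star: "bounded_linear (star :: 'a::cstar_algebra \<Rightarrow> 'a)"
  by (rule bounded_linear_intro[where K = 1])
    (simp_all add: star_add star_scaleR norm_star)

lemmas tendsto_star = bounded_linear.tendsto[OF bounded_linear_star]
lemmas continuous_on_star = bounded_linear.continuous_on[OF bounded_linear_star]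
lemmas star_zero = linear_0[OF bounded_linear.linear[OF bounded_linear_star]]

lemma scaleC_minus_left: "(- c) *\<^sub>C x = - (c *\<^sub>C (x :: 'a::cstar_algebra))"
  by (metis (no_types) mult_minus1 of_real_1 of_real_minus scaleC_scaleC scaleR_minus1_left
      scaleR_scaleC)

lemma scaleC_one: "1 *\<^sub>C x = (x :: 'a::cstar_algebra)"
  by (metis of_real_1 scaleR_one scaleR_scaleC)

lemma linear_mult_left: "linear ((*) (x :: 'a::real_algebra))"
  by (simp add: linear_iff algebra_simps)

text \<open>
  Here \<open>1 + y\<close> is a square root of \<open>1 - x\<^sup>2\<close>, written so that \<open>y\<close> makes sense without a unit. The
  equation says that \<open>y\<close> is a fixed point of \<open>y \<mapsto> -(x\<^sup>2 + y\<^sup>2) / 2\<close>, which maps the ball of radius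
  \<open>1/2\<close> to itself and contracts it by the factor \<open>1/2\<close>. Self-adjointness and commutation with \<open>x\<close>
  are closed conditions kept by the map, so they are put into the domain of the iteration.
\<close>
lemma sqrt_one_minus_square:
  fixes x :: "'a::cstar_algebra"
  assumes sa: "x\<^sup>\<star> = x" and small: "norm x \<le> 1/2"
  obtains y where "y\<^sup>\<star> = y" "x * y = y * x" "2 *\<^sub>R y + y * y = - (x * x)"
proof -
  define S where "S = {y. norm y \<le> 1/2 \<and> y\<^sup>\<star> = y \<and> x * y = y * x}"
  define f where "f y = (-1/2) *\<^sub>R (x * x + y * y)" for y
  have "closed S"
    unfolding S_def
    by (intro closed_Collect_conj closed_Collect_le closed_Collect_eq continuous_intros
        continuous_on_star)
  then have "complete S"
    by (simp add: complete_eq_closed)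
  moreover have "S \<noteq> {}"
    by (auto simp: S_def star_zero intro!: exI[of _ 0])
  moreover have "f ` S \<subseteq> S"
  proof
    fix z assume "z \<in> f ` S"
    then obtain y where y: "norm y \<le> 1/2" "y\<^sup>\<star> = y" "x * y = y * x" and z: "z = f y"
      by (auto simp: S_def)
    have sq: "norm (w * w) \<le> 1/4" if "norm w \<le> 1/2" for w :: 'a
      using norm_mult_ineq[of w w] mult_mono[OF that that] by simp
    have "norm (x * x + y * y) \<le> 1/4 + 1/4"
      by (intro order_trans[OF norm_triangle_ineq] add_mono sq y small)
    then have "norm z \<le> 1/2"
      by (simp add: z f_def)
    moreover have "x * (y * y) = y * y * x"
      by (metis mult.assoc y(3))
    then have "x * z = z * x"
      by (simp add: z f_def algebra_simps)
    moreover have "z\<^sup>\<star> = z"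
      using y sa by (simp add: z f_def star_scaleR star_add star_mult flip: scaleR_minus_left)
    ultimately show "z \<in> S"
      by (simp add: S_def)
  qed
  moreover have "dist (f y) (f z) \<le> 1/2 * dist y z" if "y \<in> S" "z \<in> S" for y z
  proof -
    have "f y - f z = (-1/2) *\<^sub>R (y * (y - z) + (y - z) * z)"
      by (simp add: f_def algebra_simps)
    then have "norm (f y - f z) = 1/2 * norm (y * (y - z) + (y - z) * z)"
      by simp
    also have "\<dots> \<le> 1/2 * (norm y * norm (y - z) + norm (y - z) * norm z)"
      by (intro mult_left_mono order_trans[OF norm_triangle_ineq] add_mono norm_mult_ineq) simp
    also have "\<dots> \<le> 1/2 * (1/2 * norm (y - z) + norm (y - z) * (1/2))"
      using that by (intro mult_left_mono add_mono mult_right_mono) (auto simp: S_def)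
    finally show ?thesis by (simp add: dist_norm)
  qed
  ultimately have "\<exists>!y\<in>S. f y = y"
    by (intro Banach_fix[where c = "1/2"]) auto
  then obtain y where y: "y \<in> S" "f y = y" by blast
  have "2 *\<^sub>R f y + y * y = - (x * x)"
    by (simp add: f_def algebra_simps flip: scaleR_add_left)
  with y that show thesis by (auto simp: S_def)
qed

text \<open>
  With \<open>y\<close> as in \<open>sqrt_one_minus_square\<close>, the operator \<open>W z = x z + \<i> (1 + y) z\<close> has
  \<open>W\<^sup>* W = x\<^sup>2 + (1 + y)\<^sup>2 = 1\<close>; the C*-identity turns this into preservation of the norm. The last
  property says that \<open>x\<close> is \<open>(W + W\<^sup>-\<^sup>1) / 2\<close>.
\<close>
lemma unitary_with_given_real_part:
  fixes x :: "'a::cstar_algebra"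
  assumes sa: "x\<^sup>\<star> = x" and small: "norm x \<le> 1/2"
  obtains W where "linear W" "\<And>z. norm (W z) = norm z" "\<And>z. W (x * z) = x * W z"
    "\<And>z. 2 *\<^sub>R W (x * z) = W (W z) + z"
proof -
  obtain y where y: "y\<^sup>\<star> = y" "x * y = y * x" "2 *\<^sub>R y + y * y = - (x * x)"
    using sqrt_one_minus_square[OF assms] .
  define J :: "'a \<Rightarrow> 'a" where "J z = \<i> *\<^sub>C z" for z
  have J: "J (u + v) = J u + J v" "J (r *\<^sub>R u) = r *\<^sub>R J u" "J (J u) = - u"
    "u * J v = J (u * v)" "J u * v = J (u * v)" "(J u)\<^sup>\<star> = - J (u\<^sup>\<star>)" for u v r
    by (simp_all add: J_def scaleC_add_right scaleR_scaleC scaleC_scaleC mult_scaleC_left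
        mult_scaleC_right star_scaleC scaleC_minus_left scaleC_one mult.commute)
  have J_diff: "J (u - v) = J u - J v" for u v
    using J(1)[of "u - v" v] by simp
  define W where "W z = x * z + J (z + y * z)" for z
  have y3: "2 *\<^sub>R (y * z) + y * (y * z) = - (x * (x * z))" for z
    using arg_cong[OF y(3), of "\<lambda>u. u * z"] by (simp add: algebra_simps)
  have xy: "x * (y * z) = y * (x * z)" for z
    by (metis mult.assoc y(2))
  show thesis
  proof
    show "linear W"
      by (simp add: linear_iff W_def J algebra_simps)
    show "W (x * z) = x * W z" for z
      by (simp add: W_def J algebra_simps xy)
    show "2 *\<^sub>R W (x * z) = W (W z) + z" for z
    proof -
      have "W (W z) + z = x * (x * z) - (2 *\<^sub>R (y * z) + y * (y * z)) + 2 *\<^sub>R J (x * z + y * (x * z))"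
        by (simp add: W_def J algebra_simps xy scaleR_2)
      also have "\<dots> = 2 *\<^sub>R W (x * z)"
        unfolding y3 by (simp add: W_def algebra_simps scaleR_2)
      finally show ?thesis by simp
    qed
    show "norm (W z) = norm z" for z
    proof -
      have "(W z)\<^sup>\<star> * W z = z\<^sup>\<star> * (x * (x * z) + (2 *\<^sub>R (y * z) + y * (y * z)) + z)"
        by (simp add: W_def J J_diff star_add star_mult sa y algebra_simps xy scaleR_2)
      also have "\<dots> = z\<^sup>\<star> * z"
        unfolding y3 by simp
      finally have "(norm (W z))\<^sup>2 = (norm z)\<^sup>2"
        by (metis cstar_identity)
      then show ?thesis by simp
    qed
  qed
qed

section \<open>The supremum bound for polynomials\<close>

lemma poly_op_commute:
  assumes "linear T" "linear S" "\<And>z. S (T z) = T (S z)"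
  shows "S (poly_op p T z) = poly_op p T (S z)"
  by (induction p)
    (simp_all add: assms poly_op_pCons linear_0 linear_add linear_scale)

lemma star_poly_op_mult:
  fixes x :: "'a::cstar_algebra"
  assumes "x\<^sup>\<star> = x"
  shows "(poly_op p ((*) x) z)\<^sup>\<star> * w = z\<^sup>\<star> * poly_op p ((*) x) w"
proof (induction p arbitrary: w)
  case (pCons c p)
  have "(poly_op (pCons c p) ((*) x) z)\<^sup>\<star> * w =
      c *\<^sub>R (z\<^sup>\<star> * w) + (poly_op p ((*) x) z)\<^sup>\<star> * (x * w)"
    by (simp add: assms poly_op_pCons linear_mult_left star_add star_mult star_scaleR
        distrib_right mult.assoc)
  also have "(poly_op p ((*) x) z)\<^sup>\<star> * (x * w) = z\<^sup>\<star> * (x * poly_op p ((*) x) w)"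
    using poly_op_commute[OF linear_mult_left linear_mult_left, of x x p w]
    by (simp add: pCons.IH)
  finally show ?case
    by (simp add: poly_op_pCons linear_mult_left distrib_left)
qed (simp add: star_zero)

text \<open>
  The operator \<open>p(x)\<close> is symmetric for the algebra-valued inner product \<open>z\<^sup>\<star> * w\<close>, so this is the
  Cauchy-Schwarz step \<open>\<parallel>T z\<parallel>\<^sup>2 \<le> \<parallel>z\<parallel> \<parallel>T\<^sup>2 z\<parallel>\<close>.
\<close>
lemma norm_poly_op_square:
  fixes x :: "'a::cstar_algebra"
  assumes "x\<^sup>\<star> = x"
  shows "(norm (poly_op p ((*) x) z))\<^sup>2 \<le> norm z * norm (poly_op (p * p) ((*) x) z)"
proof -
  have "(norm (poly_op p ((*) x) z))\<^sup>2 = norm (z\<^sup>\<star> * poly_op (p * p) ((*) x) z)"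
    by (simp add: star_poly_op_mult[OF assms] poly_op_mult linear_mult_left flip: cstar_identity)
  also have "\<dots> \<le> norm z * norm (poly_op (p * p) ((*) x) z)"
    by (metis norm_mult_ineq norm_star)
  finally show ?thesis .
qed

text \<open>
  A factor linear in the exponent is negligible against a geometric sequence, so taking \<open>2\<^sup>n\<close>-th
  roots removes it.
\<close>
lemma le_of_powers_linear_bound:
  fixes r s :: real
  assumes "0 \<le> r" "0 \<le> s" and le: "\<And>n. r ^ (2 ^ n) \<le> (a * 2 ^ n + b) * s ^ (2 ^ n)"
  shows "r \<le> s"
proof (rule ccontr)
  assume "\<not> r \<le> s"
  then have less: "s < r" by simp
  define q where "q = s / r"
  have q: "0 \<le> q" "q < 1" using less assms by (simp_all add: q_def)
  have "(\<lambda>n. (a * real n + b) * q ^ n) \<longlonglongrightarrow> a * 0 + b * 0"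
    using tendsto_add[OF tendsto_mult_left[OF powser_times_n_limit_0[of q], of a]
        tendsto_mult_left[OF LIMSEQ_power_zero[of q], of b]] q
    by (simp add: algebra_simps)
  moreover have "filterlim (\<lambda>n::nat. 2 ^ n :: nat) sequentially sequentially"
    by (rule filterlim_subseq) (simp add: strict_mono_Suc_iff)
  ultimately have "(\<lambda>n. (a * real (2 ^ n) + b) * q ^ (2 ^ n)) \<longlonglongrightarrow> a * 0 + b * 0"
    by (rule filterlim_compose)
  moreover have "1 \<le> (a * real (2 ^ n) + b) * q ^ (2 ^ n)" for n
    using le[of n] less assms by (simp add: q_def power_divide field_simps)
  ultimately show False
    using LIMSEQ_le_const[of _ "a * 0 + b * 0" 1] by fastforce
qed

text \<open>
  The bound of \<open>poly_op_isometry_sup_bound\<close> for \<open>p\<close> raised to the power \<open>2\<^sup>n\<close> has a factor that is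
  only linear in \<open>2\<^sup>n\<close>, while \<open>norm_poly_op_square\<close>, used \<open>n\<close> times, compares it with the \<open>2\<^sup>n\<close>-th
  power of the norm for \<open>p\<close>.
\<close>
theorem norm_poly_op_le:
  fixes x :: "'a::cstar_algebra"
  assumes sa: "x\<^sup>\<star> = x" and small: "norm x \<le> 1/2"
    and bound: "\<And>t. t \<in> {-1..1} \<Longrightarrow> \<bar>poly p t\<bar> \<le> B"
  shows "norm (poly_op p ((*) x) z) \<le> B * norm z"
proof (rule le_of_powers_linear_bound)
  have "B \<ge> 0" using bound[of 0] by simp
  then show "0 \<le> B * norm z" by simp
  obtain W where W: "linear W" "\<And>z. norm (W z) = norm z" "\<And>z. W (x * z) = x * W z"
    "\<And>z. 2 *\<^sub>R W (x * z) = W (W z) + z"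
    using unitary_with_given_real_part[OF sa small] by blast
  show "norm (poly_op p ((*) x) z) ^ (2 ^ n) \<le>
      (2 * real (degree p) * 2 ^ n + 3) * (B * norm z) ^ (2 ^ n)" for n
    using bound
  proof (induction n arbitrary: p B)
    case 0
    show ?case
      using poly_op_isometry_sup_bound[OF W(1,2) linear_mult_left W(3,4) 0]
      by (simp add: algebra_simps)
  next
    case (Suc n)
    have "\<bar>poly (p * p) t\<bar> \<le> B\<^sup>2" if "t \<in> {-1..1}" for t
      using Suc.prems[OF that] power_mono[of "\<bar>poly p t\<bar>" B 2] by (simp add: power2_eq_square abs_mult)
    note IH = Suc.IH[OF this]
    have deg: "real (degree (p * p)) \<le> 2 * real (degree p)"
      using degree_mult_le[of p p] by linarith
    have "norm (poly_op p ((*) x) z) ^ (2 ^ Suc n) = ((norm (poly_op p ((*) x) z))\<^sup>2) ^ (2 ^ n)"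
      by (simp flip: power_mult)
    also have "\<dots> \<le> (norm z * norm (poly_op (p * p) ((*) x) z)) ^ (2 ^ n)"
      by (intro power_mono norm_poly_op_square sa) simp
    also have "\<dots> \<le> norm z ^ (2 ^ n) * ((2 * real (degree (p * p)) * 2 ^ n + 3) * (B\<^sup>2 * norm z) ^ (2 ^ n))"
      unfolding power_mult_distrib[of "norm z"] by (intro mult_left_mono IH) simp_all
    also have "\<dots> \<le> norm z ^ (2 ^ n) * ((2 * (2 * real (degree p)) * 2 ^ n + 3) * (B\<^sup>2 * norm z) ^ (2 ^ n))"
      using deg by (intro mult_left_mono mult_right_mono add_mono) simp_all
    also have "\<dots> = (2 * real (degree p) * 2 ^ Suc n + 3) * (B * norm z) ^ (2 ^ Suc n)"
    proof -
      have "norm z ^ m * (B\<^sup>2 * norm z) ^ m = (B * norm z) ^ (2 * m)" for m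
        by (simp add: power_mult power2_eq_square ac_simps flip: power_mult_distrib)
      from this[of "2 ^ n"] show ?thesis by (simp add: ac_simps)
    qed
    finally show ?case .
  qed
qed simp

section \<open>Maximal commutative subalgebras\<close>

text \<open>
  The double commutant \<open>S''\<close> is a closed \<open>*\<close>-subalgebra containing \<open>S\<close>. As \<open>S\<close> is contained in \<open>S'\<close>,
  taking commutants twice gives that \<open>S''\<close> is contained in \<open>S'''\<close>, so \<open>S''\<close> is commutative.
\<close>
lemma double_commutant_commutative:
  fixes S :: "'a::cstar_algebra set"
  assumes comm: "\<And>x y. x \<in> S \<Longrightarrow> y \<in> S \<Longrightarrow> x * y = y * x"
    and star: "\<And>x. x \<in> S \<Longrightarrow> x\<^sup>\<star> \<in> S"
  obtains F where "commutative_cstar_subalgebra F" "S \<subseteq> F"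
proof -
  define C :: "'a set \<Rightarrow> 'a set" where "C X = {a. \<forall>x\<in>X. a * x = x * a}" for X
  have starC: "a\<^sup>\<star> \<in> C X" if "a \<in> C X" "\<And>x. x \<in> X \<Longrightarrow> x\<^sup>\<star> \<in> X" for a X
    using that by (simp add: C_def) (metis star_mult star_star)
  have multC: "a * b \<in> C X" if "a \<in> C X" "b \<in> C X" for a b X
    using that by (simp add: C_def) (metis mult.assoc)
  have antiC: "C Y \<subseteq> C X" if "X \<subseteq> Y" for X Y
    using that by (auto simp: C_def)
  have "closed (C X)" for X
    unfolding C_def Ball_def
    by (intro closed_Collect_all closed_Collect_imp closed_Collect_eq continuous_intros) simp
  then have "cstar_subalgebra (C (C S))"
    unfolding cstar_subalgebra_def
    by (auto simp: starC star multC)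
      (auto simp: C_def algebra_simps mult_scaleC_left mult_scaleC_right)
  moreover have "S \<subseteq> C (C S)" by (auto simp: C_def)
  moreover have "S \<subseteq> C S" using comm by (auto simp: C_def)
  then have "C (C S) \<subseteq> C (C (C S))" by (intro antiC)
  then have "x * y = y * x" if "x \<in> C (C S)" "y \<in> C (C S)" for x y
    using that unfolding C_def[of "C (C S)"] by blast
  ultimately show thesis
    by (intro that[of "C (C S)"]) (auto simp: commutative_cstar_subalgebra_def)
qed

text \<open>
  The subtraction is written with \<open>scaleC\<close> so that membership of both parts in a C*-subalgebra
  follows directly from its closure properties.
\<close>
lemma cartesian_decomposition:
  fixes x :: "'a::cstar_algebra"
  defines "r \<equiv> (1/2) *\<^sub>C (x + x\<^sup>\<star>)" and "s \<equiv> (- \<i>/2) *\<^sub>C (x + (-1) *\<^sub>C x\<^sup>\<star>)"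
  shows "r\<^sup>\<star> = r" "s\<^sup>\<star> = s" "x = r + \<i> *\<^sub>C s"
proof -
  show "r\<^sup>\<star> = r" by (simp add: r_def star_scaleC star_add star_star add.commute)
  show "s\<^sup>\<star> = s"
    by (simp add: s_def star_scaleC star_add star_star add.commute scaleC_add_right scaleC_scaleC)
  have "r + \<i> *\<^sub>C s = (1/2 + 1/2) *\<^sub>C x + (1/2 + (-1/2)) *\<^sub>C x\<^sup>\<star>"
    unfolding scaleC_add_left
    by (simp add: r_def s_def scaleC_scaleC scaleC_add_right)
  then show "x = r + \<i> *\<^sub>C s"
    by (simp add: scaleC_one scaleC_minus_left scaleC_add_left)
     (metis (no_types) add_cancel_right_right scaleC_one scaleR_scaleC of_real_0 scaleR_zero_left)
qed

text \<open>
  Adjoining \<open>b\<close> to \<open>E\<close> gives a commuting set, but it need not be closed under \<open>*\<close> and \<open>b\<close> need not be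
  normal. The real and imaginary parts of \<open>b\<close> also commute with \<open>E\<close> and, being self-adjoint, each of
  them can be adjoined separately.
\<close>
lemma maximal_commutative_commutant:
  fixes b :: "'a::cstar_algebra"
  assumes max: "maximal_commutative E" and comm: "\<And>f. f \<in> E \<Longrightarrow> b * f = f * b"
  shows "b \<in> E"
proof -
  have E: "commutative_cstar_subalgebra E"
    and starE: "f\<^sup>\<star> \<in> E" and addE: "f + g \<in> E" and scaleE: "k *\<^sub>C f \<in> E"
    and commE: "f * g = g * f"
    if "f \<in> E" "g \<in> E" for f g k
    using max that
    by (auto simp: maximal_commutative_def commutative_cstar_subalgebra_def cstar_subalgebra_def)
  have sa: "c \<in> E" if c: "c\<^sup>\<star> = c" "\<And>f. f \<in> E \<Longrightarrow> c * f = f * c" for c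
  proof -
    obtain F where F: "commutative_cstar_subalgebra F" "insert c E \<subseteq> F"
      by (rule double_commutant_commutative[of "insert c E"]) (use c commE starE in auto)
    with max have "F = E" by (auto simp: maximal_commutative_def)
    with F show ?thesis by auto
  qed
  have comm': "b\<^sup>\<star> * f = f * b\<^sup>\<star>" if "f \<in> E" for f
    using comm[OF starE[OF that that]] by (metis star_mult star_star)
  define r where "r = (1/2) *\<^sub>C (b + b\<^sup>\<star>)"
  define s where "s = (- \<i>/2) *\<^sub>C (b + (-1) *\<^sub>C b\<^sup>\<star>)"
  have "r \<in> E"
    by (rule sa, unfold r_def, rule cartesian_decomposition)
      (simp add: comm comm' algebra_simps mult_scaleC_left mult_scaleC_right)
  moreover have "s \<in> E"
    by (rule sa, unfold s_def, rule cartesian_decomposition)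
      (simp add: comm comm' algebra_simps mult_scaleC_left mult_scaleC_right)
  ultimately have "r + \<i> *\<^sub>C s \<in> E"
    by (simp add: addE scaleE)
  then show ?thesis
    using cartesian_decomposition(3)[of b] by (simp add: r_def s_def)
qed

lemma closed_star_normalisers:
  fixes E :: "'a::cstar_algebra set"
  assumes "closed E"
  shows "closed (star_normalisers E)"
proof -
  have "star_normalisers E = (\<Inter>e\<in>E. (\<lambda>a. a\<^sup>\<star> * e * a) -` E \<inter> (\<lambda>a. a * e * a\<^sup>\<star>) -` E)"
    by (auto simp: star_normalisers_def)
  also have "closed \<dots>"
    by (intro closed_INT ballI closed_Int closed_vimage assms continuous_intros
        continuous_on_star)
  finally show ?thesis .
qed

text \<open>
  If \<open>a * f = f' * a\<close> with \<open>f\<close> and \<open>f'\<close> self-adjoint, then \<open>f * a\<^sup>\<star> = a\<^sup>\<star> * f'\<close>, so that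
  \<open>a\<^sup>\<star> * e * a * f = a\<^sup>\<star> * e * f' * a = a\<^sup>\<star> * f' * e * a = f * a\<^sup>\<star> * e * a\<close>. The other product
  is handled in the same way, starting from \<open>f * a = a * f'\<close>.
\<close>
lemma normalisers_subset_star_normalisers:
  fixes E :: "'a::cstar_algebra set"
  assumes max: "maximal_commutative E"
  shows "normalisers (self_adjoint_part E) \<subseteq> star_normalisers E"
proof
  fix a assume a: "a \<in> normalisers (self_adjoint_part E)"
  have E: "cstar_subalgebra E" and commE: "\<And>f g. f \<in> E \<Longrightarrow> g \<in> E \<Longrightarrow> f * g = g * f"
    using max by (auto simp: maximal_commutative_def commutative_cstar_subalgebra_def)
  have *: "b \<in> E" if sa: "\<And>f. f \<in> E \<Longrightarrow> f\<^sup>\<star> = f \<Longrightarrow> b * f = f * b" for b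
  proof (rule maximal_commutative_commutant[OF max])
    fix f assume f: "f \<in> E"
    define r where "r = (1/2) *\<^sub>C (f + f\<^sup>\<star>)"
    define s where "s = (- \<i>/2) *\<^sub>C (f + (-1) *\<^sub>C f\<^sup>\<star>)"
    have "r \<in> E" "s \<in> E"
      using E f by (auto simp: r_def s_def cstar_subalgebra_def)
    then have "b * r = r * b" "b * s = s * b"
      using cartesian_decomposition[of f] by (auto simp: r_def s_def sa)
    then have "b * (r + \<i> *\<^sub>C s) = (r + \<i> *\<^sub>C s) * b"
      by (simp add: algebra_simps mult_scaleC_left mult_scaleC_right)
    then show "b * f = f * b"
      using cartesian_decomposition(3)[of f] by (simp add: r_def s_def)
  qed
  have "a\<^sup>\<star> * e * a \<in> E" if e: "e \<in> E" for e
  proof (rule *)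
    fix f assume f: "f \<in> E" "f\<^sup>\<star> = f"
    then have "a * f \<in> (\<lambda>s. s * a) ` self_adjoint_part E"
      using a by (auto simp: normalisers_def self_adjoint_part_def)
    then obtain f' where f': "f' \<in> E" "f'\<^sup>\<star> = f'" "a * f = f' * a"
      by (auto simp: self_adjoint_part_def)
    have "f * a\<^sup>\<star> = a\<^sup>\<star> * f'"
      using arg_cong[OF f'(3), of star] f(2) f'(2) by (simp add: star_mult)
    then show "a\<^sup>\<star> * e * a * f = f * (a\<^sup>\<star> * e * a)"
      using f'(3) commE[OF e f'(1)] by (metis mult.assoc)
  qed
  moreover have "a * e * a\<^sup>\<star> \<in> E" if e: "e \<in> E" for e
  proof (rule *)
    fix f assume f: "f \<in> E" "f\<^sup>\<star> = f"
    then have "f * a \<in> (\<lambda>s. a * s) ` self_adjoint_part E"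
      using a by (auto simp: normalisers_def self_adjoint_part_def)
    then obtain f' where f': "f' \<in> E" "f'\<^sup>\<star> = f'" "f * a = a * f'"
      by (auto simp: self_adjoint_part_def)
    have "a\<^sup>\<star> * f = f' * a\<^sup>\<star>"
      using arg_cong[OF f'(3), of star] f(2) f'(2) by (simp add: star_mult)
    then show "a * e * a\<^sup>\<star> * f = f * (a * e * a\<^sup>\<star>)"
      using f'(3) commE[OF e f'(1)] by (metis mult.assoc)
  qed
  ultimately show "a \<in> star_normalisers E"
    by (auto simp: star_normalisers_def)
qed

section \<open>Continuous functional calculus without a unit\<close>

lemma Weierstrass_poly:
  fixes f :: "real \<Rightarrow> real"
  assumes "continuous_on {-1..1} f" "0 < e"
  shows "\<exists>p. \<forall>t\<in>{-1..1}. \<bar>poly p t - f t\<bar> < e"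
proof -
  obtain g where g: "real_polynomial_function g" "\<And>t. t \<in> {-1..1} \<Longrightarrow> \<bar>f t - g t\<bar> < e"
    using Stone_Weierstrass_real_polynomial_function[OF compact_Icc assms] by blast
  from g(1) obtain a n where "g = (\<lambda>t. \<Sum>i\<le>n. a i * t ^ i)"
    using real_polynomial_function_imp_sum by blast
  then have "poly (\<Sum>i\<le>n. monom (a i) i) t = g t" for t
    by (simp add: poly_sum poly_monom)
  with g(2) show ?thesis
    by (metis abs_minus_commute)
qed

definition approx_poly :: "(real \<Rightarrow> real) \<Rightarrow> nat \<Rightarrow> real poly"
  where "approx_poly f n = (SOME p. \<forall>t\<in>{-1..1}. \<bar>poly p t - f t\<bar> < inverse (real (Suc n)))"

lemma approx_poly:
  assumes "continuous_on {-1..1} f" "t \<in> {-1..1}"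
  shows "\<bar>poly (approx_poly f n) t - f t\<bar> < inverse (real (Suc n))"
proof -
  have "\<exists>p. \<forall>t\<in>{-1..1}. \<bar>poly p t - f t\<bar> < inverse (real (Suc n))"
    using assms by (intro Weierstrass_poly) auto
  from someI_ex[OF this] show ?thesis
    using assms(2) unfolding approx_poly_def by blast
qed

lemma uniform_limit_approx_poly:
  assumes "continuous_on {-1..1} f"
  shows "uniform_limit {-1..1} (\<lambda>n. poly (approx_poly f n)) f sequentially"
proof (rule uniform_limitI)
  fix e :: real assume "e > 0"
  then have "eventually (\<lambda>n. inverse (real (Suc n)) < e) sequentially"
    using LIMSEQ_inverse_real_of_nat by (rule order_tendstoD(2)[rotated])
  then show "\<forall>\<^sub>F n in sequentially. \<forall>t\<in>{-1..1}. dist (poly (approx_poly f n) t) (f t) < e"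
    by eventually_elim (metis approx_poly assms dist_real_def less_trans)
qed

text \<open>
  The operator \<open>f(x)\<close>, acting by left multiplication. An operator is needed because \<open>f(0)\<close> may be
  nonzero, in which case \<open>f(x)\<close> is only a multiplier of the algebra. The choice of
  approximating polynomials is immaterial by \<open>tendsto_fun_op\<close> below.
\<close>
definition fun_op :: "(real \<Rightarrow> real) \<Rightarrow> 'a::cstar_algebra \<Rightarrow> 'a \<Rightarrow> 'a"
  where "fun_op f x z = lim (\<lambda>n. poly_op (approx_poly f n) ((*) x) z)"

locale small_self_adjoint =
  fixes x :: "'a::cstar_algebra"
  assumes self_adjoint: "x\<^sup>\<star> = x" and small: "norm x \<le> 1/2"
begin

abbreviation P :: "real poly \<Rightarrow> 'a \<Rightarrow> 'a" where "P p \<equiv> poly_op p ((*) x)"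

lemma norm_P_diff_le:
  assumes "\<And>t. t \<in> {-1..1} \<Longrightarrow> \<bar>poly p t - poly q t\<bar> \<le> B"
  shows "norm (P p z - P q z) \<le> B * norm z"
  using norm_poly_op_le[OF self_adjoint small, of "p - q" B z] assms
  by (simp add: poly_op_diff linear_mult_left)

lemma convergent_approx_poly:
  assumes "continuous_on {-1..1} f"
  shows "(\<lambda>n. P (approx_poly f n) z) \<longlonglongrightarrow> fun_op f x z"
proof -
  have "Cauchy (\<lambda>n. P (approx_poly f n) z)"
  proof (rule metric_CauchyI)
    fix e :: real assume e: "e > 0"
    define d where "d = e / (2 * (norm z + 1))"
    have d: "d > 0" using e by (simp add: d_def add_nonneg_pos)
    obtain N where N: "inverse (real (Suc N)) < d"
      using reals_Archimedean[OF d] by auto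
    show "\<exists>M. \<forall>m\<ge>M. \<forall>n\<ge>M. dist (P (approx_poly f m) z) (P (approx_poly f n) z) < e"
    proof (intro exI allI impI)
      fix m n assume mn: "m \<ge> N" "n \<ge> N"
      have close: "\<bar>poly (approx_poly f k) t - f t\<bar> \<le> d" if "k \<ge> N" "t \<in> {-1..1}" for k t
      proof -
        have "inverse (real (Suc k)) \<le> inverse (real (Suc N))"
          using that by (intro le_imp_inverse_le) simp_all
        with approx_poly[OF assms that(2), of k] N show ?thesis by linarith
      qed
      have "norm (P (approx_poly f m) z - P (approx_poly f n) z) \<le> (2 * d) * norm z"
        using close[OF mn(1)] close[OF mn(2)] by (intro norm_P_diff_le) (smt (verit))
      also have "\<dots> < (2 * d) * (norm z + 1)"
        using d by simp
      also have "\<dots> = e"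
        using norm_ge_zero[of z] by (simp add: d_def field_simps add_nonneg_eq_0_iff)
      finally show "dist (P (approx_poly f m) z) (P (approx_poly f n) z) < e"
        by (simp add: dist_norm)
    qed
  qed
  then show ?thesis
    unfolding fun_op_def by (simp add: Cauchy_convergent_iff flip: convergent_LIMSEQ_iff)
qed

lemma tendsto_fun_op:
  assumes "continuous_on {-1..1} f" "uniform_limit {-1..1} (\<lambda>n. poly (p n)) f sequentially"
  shows "(\<lambda>n. P (p n) z) \<longlonglongrightarrow> fun_op f x z"
proof -
  have "(\<lambda>n. P (p n) z - P (approx_poly f n) z) \<longlonglongrightarrow> 0"
  proof (rule LIMSEQ_I)
    fix e :: real assume e: "e > 0"
    define d where "d = e / (2 * (norm z + 1))"
    have d: "d > 0" using e by (simp add: d_def add_nonneg_pos)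
    have "eventually (\<lambda>n. norm (P (p n) z - P (approx_poly f n) z) < e) sequentially"
      using uniform_limitD[OF assms(2) d] uniform_limitD[OF uniform_limit_approx_poly[OF assms(1)] d]
    proof eventually_elim
      case (elim n)
      have "norm (P (p n) z - P (approx_poly f n) z) \<le> (2 * d) * norm z"
        using elim by (intro norm_P_diff_le) (smt (verit) dist_real_def)
      also have "\<dots> < (2 * d) * (norm z + 1)"
        using d by simp
      also have "\<dots> = e"
        using norm_ge_zero[of z] by (simp add: d_def field_simps add_nonneg_eq_0_iff)
      finally show ?case .
    qed
    then show "\<exists>no. \<forall>n\<ge>no. norm (P (p n) z - P (approx_poly f n) z - 0) < e"
      by (simp add: eventually_sequentially)
  qed
  from tendsto_add[OF this convergent_approx_poly[OF assms(1), of z]] show ?thesis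
    by simp
qed

lemma fun_op_poly: "fun_op (poly p) x z = P p z"
proof (rule LIMSEQ_unique)
  show "(\<lambda>n. P p z) \<longlonglongrightarrow> fun_op (poly p) x z"
    by (intro tendsto_fun_op continuous_intros uniform_limit_const)
qed simp

lemma fun_op_const: "fun_op (\<lambda>t. c) x z = c *\<^sub>R z"
proof -
  have "poly [:c:] = (\<lambda>t. c)" by auto
  then show ?thesis
    using fun_op_poly[of "[:c:]" z] by (simp add: poly_op_pCons linear_mult_left)
qed

lemma fun_op_id: "fun_op (\<lambda>t. t) x z = x * z"
proof -
  have "poly [:0, 1:] = (\<lambda>t::real. t)" by auto
  then show ?thesis
    using fun_op_poly[of "[:0, 1:]" z] by (simp add: poly_op_pCons linear_mult_left)
qed

lemma norm_fun_op_le: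
  assumes cont: "continuous_on {-1..1} f" and bound: "\<And>t. t \<in> {-1..1} \<Longrightarrow> \<bar>f t\<bar> \<le> B"
  shows "norm (fun_op f x z) \<le> B * norm z"
proof (rule LIMSEQ_le)
  show "(\<lambda>n. norm (P (approx_poly f n) z)) \<longlonglongrightarrow> norm (fun_op f x z)"
    by (intro tendsto_norm convergent_approx_poly cont)
  show "(\<lambda>n. (B + inverse (real (Suc n))) * norm z) \<longlonglongrightarrow> B * norm z"
    using tendsto_mult_right[OF tendsto_add[OF tendsto_const LIMSEQ_inverse_real_of_nat], of B "norm z"]
    by simp
  have "norm (P (approx_poly f n) z) \<le> (B + inverse (real (Suc n))) * norm z" for n
    using approx_poly[OF cont, of _ n] bound
    by (intro norm_poly_op_le self_adjoint small) (smt (verit))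
  then show "\<exists>N. \<forall>n\<ge>N. norm (P (approx_poly f n) z) \<le> (B + inverse (real (Suc n))) * norm z"
    by blast
qed

lemma fun_op_diff:
  assumes "continuous_on {-1..1} f" "continuous_on {-1..1} g"
  shows "fun_op (\<lambda>t. f t - g t) x z = fun_op f x z - fun_op g x z"
proof (rule LIMSEQ_unique)
  have "poly (p - q) = (\<lambda>t. poly p t - poly q t)" for p q :: "real poly"
    by auto
  then show "(\<lambda>n. P (approx_poly f n - approx_poly g n) z) \<longlonglongrightarrow> fun_op (\<lambda>t. f t - g t) x z"
    using assms uniform_limit_minus[OF uniform_limit_approx_poly uniform_limit_approx_poly, of f g]
    by (intro tendsto_fun_op continuous_intros) simp_all
  show "(\<lambda>n. P (approx_poly f n - approx_poly g n) z) \<longlonglongrightarrow> fun_op f x z - fun_op g x z"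
    using assms by (simp add: poly_op_diff linear_mult_left convergent_approx_poly tendsto_diff)
qed

lemma fun_op_mult:
  assumes f: "continuous_on {-1..1} f" and g: "continuous_on {-1..1} g"
  shows "fun_op (\<lambda>t. f t * g t) x z = fun_op f x (fun_op g x z)"
proof (rule LIMSEQ_unique)
  have bounded: "bounded (f ` {-1..1})" "bounded (g ` {-1..1})"
    using f g by (auto intro!: compact_imp_bounded compact_continuous_image)
  have "poly (p * q) = (\<lambda>t. poly p t * poly q t)" for p q :: "real poly"
    by auto
  then show "(\<lambda>n. P (approx_poly f n * approx_poly g n) z) \<longlonglongrightarrow> fun_op (\<lambda>t. f t * g t) x z"
    using uniform_lim_mult[OF uniform_limit_approx_poly[OF f] uniform_limit_approx_poly[OF g] bounded]
      f g
    by (intro tendsto_fun_op continuous_intros) simp_all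
  obtain B where B: "\<And>t. t \<in> {-1..1} \<Longrightarrow> \<bar>f t\<bar> \<le> B"
    using bounded(1) unfolding bounded_iff by (metis imageI real_norm_def)
  let ?w = "fun_op g x z" and ?v = "\<lambda>n. P (approx_poly g n) z"
  have "(\<lambda>n. P (approx_poly f n) (?v n - ?w)) \<longlonglongrightarrow> 0"
  proof (rule Lim_null_comparison)
    have "norm (P (approx_poly f n) u) \<le> (B + 1) * norm u" for n u
    proof (rule norm_poly_op_le[OF self_adjoint small])
      fix t :: real assume t: "t \<in> {-1..1}"
      have "inverse (real (Suc n)) \<le> 1" by (simp add: inverse_le_1_iff)
      with approx_poly[OF f t, of n] B[OF t] show "\<bar>poly (approx_poly f n) t\<bar> \<le> B + 1" by linarith
    qed
    then show "\<forall>\<^sub>F n in sequentially. norm (P (approx_poly f n) (?v n - ?w)) \<le> (B + 1) * norm (?v n - ?w)"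
      by simp
    show "(\<lambda>n. (B + 1) * norm (?v n - ?w)) \<longlonglongrightarrow> 0"
      using LIM_zero[OF convergent_approx_poly[OF g, of z]]
      by (intro tendsto_mult_right_zero tendsto_norm_zero)
  qed
  from tendsto_add[OF this convergent_approx_poly[OF f, of ?w]]
  show "(\<lambda>n. P (approx_poly f n * approx_poly g n) z) \<longlonglongrightarrow> fun_op f x ?w"
    by (simp add: poly_op_mult linear_mult_left linear_diff[OF linear_poly_op])
qed

lemma fun_op_mult_right:
  assumes "continuous_on {-1..1} f"
  shows "fun_op f x z * w = fun_op f x (z * w)"
proof (rule LIMSEQ_unique)
  have "P p z * w = P p (z * w)" for p
    using poly_op_commute[OF linear_mult_left, of "\<lambda>z. z * w" x p z]
    by (simp add: linear_iff algebra_simps)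
  then show "(\<lambda>n. P (approx_poly f n) (z * w)) \<longlonglongrightarrow> fun_op f x z * w"
    using tendsto_mult[OF convergent_approx_poly[OF assms, of z] tendsto_const[of w]] by simp
qed (intro convergent_approx_poly assms)

lemma fun_op_mult_left:
  assumes "continuous_on {-1..1} f" "b * x = x * b"
  shows "b * fun_op f x z = fun_op f x (b * z)"
proof (rule LIMSEQ_unique)
  have "b * P p z = P p (b * z)" for p
    using assms(2) poly_op_commute[OF linear_mult_left linear_mult_left, of b x p z]
    by (metis mult.assoc)
  then show "(\<lambda>n. P (approx_poly f n) (b * z)) \<longlonglongrightarrow> b * fun_op f x z"
    using tendsto_mult[OF tendsto_const[of b] convergent_approx_poly[OF assms(1), of z]] by simp
qed (intro convergent_approx_poly assms)

text \<open>
  If \<open>z\<close> commutes with \<open>x\<close>, the adjoint \<open>z\<^sup>\<star> f(x)\<close> of \<open>f(x) z\<close> is again the result of a left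
  multiplication by \<open>f(x)\<close>.
\<close>
lemma star_fun_op:
  assumes f: "continuous_on {-1..1} f" and comm: "x * z = z * x"
  shows "(fun_op f x z)\<^sup>\<star> = fun_op f x (z\<^sup>\<star>)"
proof (rule LIMSEQ_unique)
  have comm': "x * z\<^sup>\<star> = z\<^sup>\<star> * x"
    using arg_cong[OF comm, of star] by (simp add: star_mult self_adjoint)
  have "(P p z)\<^sup>\<star> = P p (z\<^sup>\<star>)" for p
  proof (induction p)
    case (pCons c p)
    have "P p (z\<^sup>\<star>) * x = x * P p (z\<^sup>\<star>)"
      using poly_op_commute[OF linear_mult_left, of "\<lambda>z. z * x" x p "z\<^sup>\<star>"]
        poly_op_commute[OF linear_mult_left linear_mult_left, of x x p "z\<^sup>\<star>"] comm'
      by (simp add: linear_iff algebra_simps)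
    with pCons.IH show ?case
      by (simp add: poly_op_pCons linear_mult_left star_add star_scaleR star_mult self_adjoint)
  qed (simp add: star_zero)
  then show "(\<lambda>n. P (approx_poly f n) (z\<^sup>\<star>)) \<longlonglongrightarrow> (fun_op f x z)\<^sup>\<star>"
    using tendsto_star[OF convergent_approx_poly[OF f, of z]] by simp
qed (intro convergent_approx_poly f)

lemma fun_op_in_subalgebra:
  assumes f: "continuous_on {-1..1} f"
    and E: "cstar_subalgebra E" and "x \<in> E" "z \<in> E"
  shows "fun_op f x z \<in> E"
proof (rule closed_sequentially)
  show "closed E" using E by (simp add: cstar_subalgebra_def)
  have "P p z \<in> E" for p
    using E \<open>x \<in> E\<close> \<open>z \<in> E\<close>
    by (induction p)
      (simp_all add: poly_op_pCons linear_mult_left cstar_subalgebra_def scaleR_scaleC)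
  then show "P (approx_poly f n) z \<in> E" for n .
qed (rule convergent_approx_poly[OF f])

text \<open>
  The element \<open>b = f(x) x\<close> is the multiplier \<open>t f(t)\<close> at \<open>x\<close> applied to a missing unit. Applying that
  multiplier to \<open>b\<close> instead gives \<open>b\<^sup>2\<close>, whose norm is \<open>\<parallel>b\<parallel>\<^sup>2\<close>.
\<close>
lemma norm_fun_op_self_le:
  assumes f: "continuous_on {-1..1} f" and bound: "\<And>t. t \<in> {-1..1} \<Longrightarrow> \<bar>f t * t\<bar> \<le> B"
  shows "norm (fun_op f x x) \<le> B"
proof (cases "fun_op f x x = 0")
  case True
  then show ?thesis using bound[of 0] by simp
next
  case False
  let ?b = "fun_op f x x"
  have "(norm ?b)\<^sup>2 = norm (?b * ?b)"
    using cstar_identity[of ?b] by (simp add: star_fun_op[OF f] self_adjoint)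
  also have "?b * ?b = fun_op (\<lambda>t. f t * t) x ?b"
    using f by (simp add: fun_op_mult fun_op_id fun_op_mult_right)
  also have "norm \<dots> \<le> B * norm ?b"
    using f bound by (intro norm_fun_op_le continuous_intros)
  finally show ?thesis
    using False by (simp add: power2_eq_square)
qed

end

section \<open>Approximating a star-normaliser\<close>

text \<open>
  The approximant is \<open>c = g(y) a\<close> with \<open>y = a * a\<^sup>\<star>\<close>, where \<open>g\<close> cuts off a neighbourhood of \<open>0\<close> of
  radius \<open>d\<close>. With \<open>h(t) = 1/t\<close> outside that neighbourhood, \<open>g(y) = g(y) h(y) y\<close>; the factor \<open>y\<close>
  supplies an \<open>a\<close> and an \<open>a\<^sup>\<star>\<close> that turn a self-adjoint \<open>e\<close> in \<open>E\<close> on one side of \<open>c\<close> into a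
  self-adjoint element of \<open>E\<close> on the other side.
\<close>
lemma near_normaliser:
  fixes E :: "'a::cstar_algebra set"
  assumes E: "commutative_cstar_subalgebra E" and a: "a \<in> star_normalisers E"
    and in_E: "a\<^sup>\<star> * a \<in> E" "a * a\<^sup>\<star> \<in> E" and small: "norm (a * a\<^sup>\<star>) \<le> 1/2" and d: "d > 0"
  obtains c where "c \<in> normalisers (self_adjoint_part E)" "(norm (a - c))\<^sup>2 \<le> 2 * d"
proof -
  define y where "y = a * a\<^sup>\<star>"
  have sub: "cstar_subalgebra E" and commE: "\<And>e f. e \<in> E \<Longrightarrow> f \<in> E \<Longrightarrow> e * f = f * e"
    using E by (auto simp: commutative_cstar_subalgebra_def)
  have y: "y \<in> E" using in_E by (simp add: y_def)
  interpret small_self_adjoint y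
    using small by unfold_locales (simp_all add: y_def star_mult star_star)
  define g where "g t = max 0 (min 1 (\<bar>t\<bar> / d - 1))" for t :: real
  \<comment> \<open>\<open>1/t\<close> for \<open>\<bar>t\<bar> \<ge> d\<close>, continued linearly across \<open>0\<close>\<close>
  define h where "h t = t / max (t\<^sup>2) (d\<^sup>2)" for t :: real
  have "max (t\<^sup>2) (d\<^sup>2) \<noteq> 0" for t
    using d by (metis less_max_iff_disj less_irrefl zero_less_power)
  then have h: "continuous_on {-1..1} h"
    unfolding h_def by (intro continuous_intros) auto
  have g: "continuous_on {-1..1} g"
    unfolding g_def using d by (intro continuous_intros) auto
  have ghg: "g t * (h t * t) = g t" for t
  proof (cases "\<bar>t\<bar> \<le> d")
    case True
    then have "\<bar>t\<bar> / d \<le> 1" using d by simp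
    then show ?thesis by (simp add: g_def)
  next
    case False
    then have "d\<^sup>2 \<le> t\<^sup>2" "t \<noteq> 0" using d by (auto simp: abs_le_square_iff[symmetric])
    then show ?thesis by (simp add: h_def max_absorb1 power2_eq_square)
  qed
  let ?G = "fun_op g y" and ?H = "fun_op h y"
  have GH: "?G z = ?G (?H (y * z))" for z
  proof -
    have "?G z = fun_op (\<lambda>t. g t * (h t * t)) y z" by (simp add: ghg)
    also have "\<dots> = ?G (?H (y * z))"
      using g h by (simp add: fun_op_mult fun_op_id continuous_on_mult continuous_on_id)
    finally show ?thesis .
  qed
  have H_sa: "?H e \<in> self_adjoint_part E" if "e \<in> self_adjoint_part E" for e
    using that star_fun_op[OF h commE[OF y], of e] fun_op_in_subalgebra[OF h sub y, of e]
    by (auto simp: self_adjoint_part_def)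
  have ee: "a\<^sup>\<star> * e * a \<in> self_adjoint_part E" "a * e * a\<^sup>\<star> \<in> self_adjoint_part E"
    if "e \<in> self_adjoint_part E" for e
    using that a by (auto simp: self_adjoint_part_def star_normalisers_def star_mult star_star mult.assoc)
  have E_sa: "e \<in> E" if "e \<in> self_adjoint_part E" for e
    using that by (simp add: self_adjoint_part_def)
  define c where "c = ?G a"
  \<comment> \<open>\<open>y * a * e = a * (a\<^sup>\<star> * a) * e = (a * e * a\<^sup>\<star>) * a\<close>, since \<open>a\<^sup>\<star> * a\<close> commutes with \<open>e\<close>\<close>
  have right: "c * e = ?H (a * e * a\<^sup>\<star>) * c" if e: "e \<in> self_adjoint_part E" for e
  proof -
    let ?k = "a * e * a\<^sup>\<star>"
    have "y * (a * e) = ?k * a"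
      using commE[OF in_E(1) E_sa[OF e]] by (simp add: y_def mult.assoc)
    then have "c * e = ?G (?H (?k * a))"
      using GH[of "a * e"] by (simp add: c_def fun_op_mult_right[OF g])
    also have "?H (?k * a) = ?H ?k * a"
      by (rule fun_op_mult_right[OF h, symmetric])
    also have "?G (?H ?k * a) = ?H ?k * c"
      unfolding c_def
      by (rule fun_op_mult_left[OF g, symmetric]) (rule commE[OF E_sa[OF H_sa[OF ee(2)[OF e]]] y])
    finally show ?thesis .
  qed
  \<comment> \<open>\<open>y * h(y) e * a = a * (a\<^sup>\<star> * h(y) e * a)\<close>, since \<open>y\<close> is \<open>a * a\<^sup>\<star>\<close>\<close>
  have left: "e * c = c * (a\<^sup>\<star> * ?H e * a)" if e: "e \<in> self_adjoint_part E" for e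
  proof -
    have "e * c = ?G (?H (y * (e * a)))"
      using commE[OF E_sa[OF e] y] by (simp add: c_def fun_op_mult_left[OF g] flip: GH)
    also have "?H (y * (e * a)) = y * ?H e * a"
      by (simp add: fun_op_mult_left[OF h] fun_op_mult_right[OF h] mult.assoc)
    also have "\<dots> = a * (a\<^sup>\<star> * ?H e * a)"
      by (simp add: y_def mult.assoc)
    finally show ?thesis
      by (simp add: c_def fun_op_mult_right[OF g])
  qed
  have "c \<in> normalisers (self_adjoint_part E)"
    unfolding normalisers_def mem_Collect_eq
  proof (intro subset_antisym image_subsetI)
    fix e assume e: "e \<in> self_adjoint_part E"
    show "c * e \<in> (\<lambda>s. s * c) ` self_adjoint_part E"
      using right[OF e] H_sa[OF ee(2)[OF e]] by (rule image_eqI)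
    show "e * c \<in> (\<lambda>s. c * s) ` self_adjoint_part E"
      using left[OF e] ee(1)[OF H_sa[OF e]] by (rule image_eqI)
  qed
  moreover have "(norm (a - c))\<^sup>2 \<le> 2 * d"
  proof -
    let ?k = "\<lambda>t. 1 - g t"
    let ?w = "fun_op ?k y a"
    have k: "continuous_on {-1..1} ?k" using g by (intro continuous_intros)
    have "a - c = ?w"
      using g by (simp add: c_def fun_op_diff fun_op_const)
    \<comment> \<open>the C*-identity for \<open>?w\<^sup>\<star>\<close>: the product \<open>?w * ?w\<^sup>\<star>\<close> contains \<open>a * a\<^sup>\<star> = y\<close>\<close>
    have "(norm ?w)\<^sup>2 = norm (?w * ?w\<^sup>\<star>)"
      using cstar_identity[of "?w\<^sup>\<star>"] by (simp add: star_star norm_star)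
    also have "?w * ?w\<^sup>\<star> = fun_op ?k y (a * ?w\<^sup>\<star>)"
      by (simp add: fun_op_mult_right[OF k])
    also have "a * ?w\<^sup>\<star> = (?w * a\<^sup>\<star>)\<^sup>\<star>"
      by (simp add: star_mult star_star)
    also have "\<dots> = fun_op ?k y y"
      by (simp add: fun_op_mult_right[OF k] star_fun_op[OF k] self_adjoint flip: y_def)
    also have "fun_op ?k y (fun_op ?k y y) = fun_op (\<lambda>t. ?k t * ?k t) y y"
      by (simp add: fun_op_mult k)
    also have "norm \<dots> \<le> 2 * d"
    proof (rule norm_fun_op_self_le)
      show "continuous_on {-1..1} (\<lambda>t. ?k t * ?k t)" using g by (intro continuous_intros)
      show "\<bar>?k t * ?k t * t\<bar> \<le> 2 * d" for t
      proof (cases "\<bar>t\<bar> \<le> 2 * d")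
        case True
        have "0 \<le> ?k t" "?k t \<le> 1" by (auto simp: g_def)
        then have "\<bar>?k t * ?k t * t\<bar> \<le> 1 * \<bar>t\<bar>"
          unfolding abs_mult by (intro mult_right_mono) (auto intro: mult_le_one)
        with True show ?thesis by simp
      next
        case False
        then have "2 \<le> \<bar>t\<bar> / d" using d by (simp add: field_simps)
        then have "?k t = 0" by (simp add: g_def)
        with d show ?thesis by simp
      qed
    qed
    finally show ?thesis using \<open>a - c = ?w\<close> by simp
  qed
  ultimately show thesis using that by blast
qed

lemma star_normalisers_scaleR:
  assumes "cstar_subalgebra E" "a \<in> star_normalisers E"
  shows "r *\<^sub>R a \<in> star_normalisers E"
  using assms by (auto simp: star_normalisers_def cstar_subalgebra_def star_scaleR scaleR_scaleC
    star_scaleC mult_scaleC_left mult_scaleC_right image_subset_iff)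

lemma normalisers_scaleR:
  fixes c :: "'a::cstar_algebra"
  assumes "c \<in> normalisers S"
  shows "r *\<^sub>R c \<in> normalisers S"
proof -
  have "(\<lambda>s. r *\<^sub>R c * s) ` S = (*\<^sub>R) r ` (\<lambda>s. c * s) ` S"
    "(\<lambda>s. s * r *\<^sub>R c) ` S = (*\<^sub>R) r ` (\<lambda>s. s * c) ` S"
    by (simp_all add: image_image)
  with assms show ?thesis by (simp add: normalisers_def)
qed

text \<open>
  \<open>a\<^sup>\<star> * a\<close> is the limit of \<open>a\<^sup>\<star> * u i * a\<close>, and \<open>a * a\<^sup>\<star>\<close> that of \<open>a * u i * a\<^sup>\<star>\<close>.
\<close>
lemma star_mult_self_in_subalgebra:
  fixes E :: "'a::cstar_algebra set"
  assumes "closed E" "approximate_unit u D" "range u \<subseteq> E" "a \<in> star_normalisers E"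
  shows "a\<^sup>\<star> * a \<in> E" "a * a\<^sup>\<star> \<in> E"
proof -
  have D: "D \<noteq> bot" and lim: "((\<lambda>i. u i * b) \<longlongrightarrow> b) D" for b
    using assms(2) by (auto simp: approximate_unit_def)
  have in_E: "a\<^sup>\<star> * (u i * a) \<in> E" "a * (u i * a\<^sup>\<star>) \<in> E" for i
    using assms(3,4) by (auto simp: star_normalisers_def image_subset_iff mult.assoc)
  show "a\<^sup>\<star> * a \<in> E"
    by (rule Lim_in_closed_set[OF assms(1) _ D tendsto_mult[OF tendsto_const lim]])
      (simp add: in_E)
  show "a * a\<^sup>\<star> \<in> E"
    by (rule Lim_in_closed_set[OF assms(1) _ D tendsto_mult[OF tendsto_const lim]])
      (simp add: in_E)
qed

lemma star_normalisers_subset_closure: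
  fixes E :: "'a::cstar_algebra set"
  assumes E: "commutative_cstar_subalgebra E" and u: "approximate_unit u D" "range u \<subseteq> E"
  shows "star_normalisers E \<subseteq> closure (normalisers (self_adjoint_part E))"
proof
  fix a assume a: "a \<in> star_normalisers E"
  have sub: "cstar_subalgebra E" and closed: "closed E"
    using E by (auto simp: commutative_cstar_subalgebra_def cstar_subalgebra_def)
  \<comment> \<open>rescaling by \<open>s\<close> brings \<open>a * a\<^sup>\<star>\<close> into the range of the functional calculus\<close>
  define s where "s = 2 * (norm a + 1)"
  define b where "b = (1 / s) *\<^sub>R a"
  have s: "s > 0" by (simp add: s_def add_nonneg_pos)
  have b: "b \<in> star_normalisers E"
    unfolding b_def by (rule star_normalisers_scaleR[OF sub a])
  have "norm b \<le> 1/2"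
    using s by (simp add: b_def s_def field_simps)
  then have "norm (b * b\<^sup>\<star>) \<le> 1/2 * (1/2)"
    using norm_mult_ineq[of b "b\<^sup>\<star>"] mult_mono[of "norm b" "1/2" "norm b" "1/2"]
    by (simp add: norm_star)
  then have small: "norm (b * b\<^sup>\<star>) \<le> 1/2" by simp
  show "a \<in> closure (normalisers (self_adjoint_part E))"
    unfolding closure_approachable
  proof (intro allI impI)
    fix e :: real assume e: "e > 0"
    then have "(e / s)\<^sup>2 / 8 > 0" using s by simp
    then obtain c where c: "c \<in> normalisers (self_adjoint_part E)"
      "(norm (b - c))\<^sup>2 \<le> 2 * ((e / s)\<^sup>2 / 8)"
      using near_normaliser[OF E b star_mult_self_in_subalgebra[OF closed u b] small] by blast
    have "2 * ((e / s)\<^sup>2 / 8) < (e / s)\<^sup>2"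
      using e s by simp
    with c(2) have "(norm (b - c))\<^sup>2 < (e / s)\<^sup>2"
      by linarith
    then have "norm (b - c) < e / s"
      using e s by (intro power2_less_imp_less[of "norm (b - c)"]) auto
    then have "s * norm (b - c) < e"
      using s by (simp add: field_simps)
    moreover have "s *\<^sub>R c - a = s *\<^sub>R (c - b)"
      using s by (simp add: b_def algebra_simps)
    then have "dist (s *\<^sub>R c) a = s * norm (b - c)"
      using s by (simp add: dist_norm norm_minus_commute)
    ultimately have "dist (s *\<^sub>R c) a < e" by linarith
    then show "\<exists>z\<in>normalisers (self_adjoint_part E). dist z a < e"
      using normalisers_scaleR[OF c(1)] by blast
  qed
qed

theorem theorem2p16:
  fixes E :: "'a::cstar_algebra set"
    and u :: "'i \<Rightarrow> 'a" and D :: "'i filter"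
  assumes "commutative_cstar_subalgebra E"
    and "approximate_unit u D" and "range u \<subseteq> E"
  shows "star_normalisers E \<subseteq> closure (normalisers (self_adjoint_part E)) \<and>
    (maximal_commutative E \<longrightarrow>
      star_normalisers E = closure (normalisers (self_adjoint_part E)))"
proof (intro conjI impI)
  show sub: "star_normalisers E \<subseteq> closure (normalisers (self_adjoint_part E))"
    by (rule star_normalisers_subset_closure[OF assms])
  assume max: "maximal_commutative E"
  have "closed E"
    using assms(1) by (simp add: commutative_cstar_subalgebra_def cstar_subalgebra_def)
  then have "closure (normalisers (self_adjoint_part E)) \<subseteq> star_normalisers E"
    by (intro closure_minimal normalisers_subset_star_normalisers max closed_star_normalisers)
  with sub show "star_normalisers E = closure (normalisers (self_adjoint_part E))"
    by (rule subset_antisym)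
qed

end
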